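(* The integer $\mathrm{Ocat}(-,-)$ is a homotopy invariant of stratified spaces: if $(X,\mathcal{F}_X)$ and $(X',\mathcal{F}_{X'})$ are stratified spaces and there exist stratified maps $f\colon (X,\mathcal{F}_X)\to (X',\mathcal{F}_{X'})$ and $g\colon (X',\mathcal{F}_{X'})\to (X,\mathcal{F}_X)$ with $f\circ g\simeq_{\mathcal{S}}\mathrm{id}_{X'}$ and $g\circ f\simeq_{\mathcal{S}}\mathrm{id}_X$, then $$\mathrm{Ocat}(X,\mathcal{F}_X)=\mathrm{Ocat}(X',\mathcal{F}_{X'}).$$
   Context: A stratified space $(X,\mathcal{F}_X)$ is a topological space $X$ together with a partition $\mathcal{F}_X$ of $X$ whose elements (called strata) are path-connected subspaces of $X$. A stratified map between spaces with partitions is a continuous map sending any two points of a common stratum of the source to points of a common stratum of the target. The product $(X,\mathcal{F}_X)\times(Y,\mathcal{F}_Y)$ has as strata the products $S\times S'$ of strata. The interval $I=[0,1]$ carries the trivial partition $\mathcal{F}_I=\{[0,1]\}$. If $U\subseteq X$ is a subspace, the induced stratification $\mathcal{F}_U$ has for strata the connected components of the intersections $U\cap S$, $S\in\mathcal{F}_X$. Two stratified maps $f,g\colon (X,\mathcal{F}_X)\to (Y,\mathcal{F}_Y)$ are $\mathcal{S}$-homotopic, written $f\simeq_{\mathcal{S}}g$, if there is a stratified map $H\colon (X,\mathcal{F}_X)\times (I,\mathcal{F}_I)\to (Y,\mathcal{F}_Y)$ with $f=H(-,0)$ and $g=H(-,1)$. Let $A\subseteq X$. A non-empty subset $U$ of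 $X$ is $A$-categorical if there is a stratified map $H\colon (U,\mathcal{F}_U)\times (I,\mathcal{F}_I)\to (X,\mathcal{F}_X)$ such that $H(x,0)=x$ and $H(x,1)\in A$ for all $x\in U$. $\mathrm{Ocat}(X,A,\mathcal{F}_X)$ is the least integer $n\ge 0$ such that $X$ is covered by $n+1$ open sets which are $A$-categorical ($\infty$ if there is no such covering). A subspace $A\subseteq X$ is transverse to the stratification, written $A\pitchfork\mathcal{F}_X$, if for every stratum $S\in\mathcal{F}_X$ the set $A\cap S$ is at most countable. Then $$\mathrm{Ocat}(X,\mathcal{F}_X)=\inf\{\mathrm{Ocat}(X,A,\mathcal{F}_X)\mid A\pitchfork\mathcal{F}_X\}.$$ *)

theory Defs
  imports "HOL-Analysis.Analysis" "HOL-Library.Disjoint_Sets" "HOL-Library.Extended_Nat"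
begin

definition stratified_space :: "'a topology \<Rightarrow> 'a set set \<Rightarrow> bool" where
  "stratified_space X F \<longleftrightarrow>
     partition_on (topspace X) F \<and> (\<forall>S\<in>F. path_connectedin X S)"

text \<open>
  Stratified maps are defined for arbitrary partitioned spaces: the induced partition of a
  subspace need not have path-connected members.
\<close>

definition stratified_map ::
  "'a topology \<Rightarrow> 'a set set \<Rightarrow> 'b topology \<Rightarrow> 'b set set \<Rightarrow> ('a \<Rightarrow> 'b) \<Rightarrow> bool" where
  "stratified_map X F Y G f \<longleftrightarrow>
     continuous_map X Y f \<and> (\<forall>S\<in>F. \<forall>x\<in>S. \<forall>y\<in>S. \<exists>T\<in>G. f x \<in> T \<and> f y \<in> T)"

definition prod_strata :: "'a set set \<Rightarrow> 'b set set \<Rightarrow> ('a \<times> 'b) set set" where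
  "prod_strata F G = {S \<times> T | S T. S \<in> F \<and> T \<in> G}"

abbreviation unit_interval :: "real topology" where
  "unit_interval \<equiv> top_of_set {0..1}"

abbreviation unit_interval_strata :: "real set set" where
  "unit_interval_strata \<equiv> {{0..1}}"

definition induced_strata :: "'a topology \<Rightarrow> 'a set set \<Rightarrow> 'a set \<Rightarrow> 'a set set" where
  "induced_strata X F U = (\<Union>S\<in>F. connected_components_of (subtopology X (U \<inter> S)))"

text \<open>
  Functions are total on the underlying types, so equalities of maps are required on the
  topological space only.
\<close>

definition S_homotopic ::
  "'a topology \<Rightarrow> 'a set set \<Rightarrow> 'b topology \<Rightarrow> 'b set set \<Rightarrow> ('a \<Rightarrow> 'b) \<Rightarrow> ('a \<Rightarrow> 'b) \<Rightarrow> bool" where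
  "S_homotopic X F Y G f g \<longleftrightarrow>
     stratified_map X F Y G f \<and> stratified_map X F Y G g \<and>
     (\<exists>H. stratified_map (prod_topology X unit_interval) (prod_strata F unit_interval_strata) Y G H \<and>
          (\<forall>x\<in>topspace X. H (x, 0) = f x \<and> H (x, 1) = g x))"

definition categorical :: "'a topology \<Rightarrow> 'a set \<Rightarrow> 'a set set \<Rightarrow> 'a set \<Rightarrow> bool" where
  "categorical X A F U \<longleftrightarrow>
     U \<subseteq> topspace X \<and> U \<noteq> {} \<and>
     (\<exists>H. stratified_map (prod_topology (subtopology X U) unit_interval)
            (prod_strata (induced_strata X F U) unit_interval_strata) X F H \<and>
          (\<forall>x\<in>U. H (x, 0) = x \<and> H (x, 1) \<in> A))"

text \<open>
  In \<^typ>\<open>enat\<close> the infimum of the empty set is \<open>\<infinity>\<close>, and the infimum of a non-empty set is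
  its least element.
\<close>

definition Ocat_rel :: "'a topology \<Rightarrow> 'a set \<Rightarrow> 'a set set \<Rightarrow> enat" where
  "Ocat_rel X A F =
     Inf {enat n | n. \<exists>U :: nat \<Rightarrow> 'a set.
            (\<forall>i\<le>n. openin X (U i) \<and> categorical X A F (U i)) \<and> topspace X = (\<Union>i\<le>n. U i)}"

definition transverse :: "'a topology \<Rightarrow> 'a set \<Rightarrow> 'a set set \<Rightarrow> bool" where
  "transverse X A F \<longleftrightarrow> A \<subseteq> topspace X \<and> (\<forall>S\<in>F. countable (A \<inter> S))"

definition Ocat :: "'a topology \<Rightarrow> 'a set set \<Rightarrow> enat" where
  "Ocat X F = Inf {Ocat_rel X A F | A. transverse X A F}"

end

theory Submission
  imports Defs
begin

text \<open>
  By symmetry it suffices to show that \<open>Ocat X' \<le> Ocat X\<close>. Given a transverse \<open>A\<close> and a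
  cover of \<open>X\<close> by \<open>A\<close>-categorical open sets \<open>U\<close>, the open sets \<open>g -` U\<close> cover \<open>X'\<close>, and on
  each of them one first deforms the inclusion to \<open>f \<circ> g\<close> and then applies \<open>f\<close> to the
  deformation of \<open>U\<close>, ending up in \<open>f ` A\<close>. Two points need care.

  First, \<open>f ` A\<close> has to be transverse. A countable set has a countable image, but \<open>f\<close> might send
  uncountably many strata of \<open>X\<close> into one stratum of \<open>X'\<close>. It does not: a stratified homotopy
  moves every point within its stratum, so \<open>g \<circ> f\<close> maps each stratum into itself, and hence
  \<open>f\<close> sends different strata into different strata.

  Second, categorical sets are non-empty while \<open>g -` U\<close> may be empty. An empty member of the
  cover of \<open>X'\<close> is replaced by a copy of a non-empty one, which exists because \<open>f\<close> maps the
  non-empty space \<open>X\<close> to \<open>X'\<close>.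

  A homotopy that starts at a stratified map is stratified exactly when each point stays in its
  stratum along the homotopy. So stratified homotopies are glued and composed like ordinary
  homotopies with a pointwise side condition, which refers to the strata of the target alone.
  This also turns the definition of a categorical set, with the connected components in its
  induced stratification, into a condition on the strata of \<open>X\<close>.
\<close>

section \<open>Points of a common stratum\<close>

definition same_stratum :: "'a set set \<Rightarrow> 'a \<Rightarrow> 'a \<Rightarrow> bool" where
  "same_stratum F x y \<longleftrightarrow> (\<exists>S\<in>F. x \<in> S \<and> y \<in> S)"

lemma same_stratum_sym: "same_stratum F x y \<Longrightarrow> same_stratum F y x"
  by (auto simp: same_stratum_def)

lemma same_stratum_trans:
  assumes "partition_on Z F" "same_stratum F x y" "same_stratum F y z"
  shows "same_stratum F x z"
proof -
  obtain S T where S: "S \<in> F" "x \<in> S" "y \<in> S" and T: "T \<in> F" "y \<in> T" "z \<in> T"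
    using assms(2,3) by (auto simp: same_stratum_def)
  have "S = T"
    using partition_onD2[OF assms(1)] S T by (auto simp: disjoint_def)
  with S T show ?thesis
    by (auto simp: same_stratum_def)
qed

lemma stratified_map_same_stratum:
  "stratified_map X F Y G f \<Longrightarrow> same_stratum F x y \<Longrightarrow> same_stratum G (f x) (f y)"
  by (auto simp: stratified_map_def same_stratum_def)

section \<open>Homotopies along strata\<close>

text \<open>
  The condition compares every stage of the homotopy with its start. It is thus a property of the
  single stages, as \<^const>\<open>homotopic_with\<close> demands, and still implies that the whole track of a
  point lies in one stratum.
\<close>

definition homotopic_along_strata ::
  "'a topology \<Rightarrow> 'b topology \<Rightarrow> 'b set set \<Rightarrow> ('a \<Rightarrow> 'b) \<Rightarrow> ('a \<Rightarrow> 'b) \<Rightarrow> bool" where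
  "homotopic_along_strata X Y G p q \<longleftrightarrow>
     homotopic_with (\<lambda>h. \<forall>x\<in>topspace X. same_stratum G (p x) (h x)) X Y p q"

lemma homotopic_along_strata_endpoint:
  "homotopic_along_strata X Y G p q \<Longrightarrow> x \<in> topspace X \<Longrightarrow> same_stratum G (p x) (q x)"
  unfolding homotopic_along_strata_def by (auto dest: homotopic_with_imp_property)

lemma homotopic_along_strata_rebase:
  assumes G: "partition_on Z G" and "\<And>x. x \<in> topspace X \<Longrightarrow> same_stratum G (p x) (r x)"
    and "homotopic_with (\<lambda>h. \<forall>x\<in>topspace X. same_stratum G (r x) (h x)) X Y s t"
  shows "homotopic_with (\<lambda>h. \<forall>x\<in>topspace X. same_stratum G (p x) (h x)) X Y s t"
  using assms(3)
  by (rule homotopic_with_mono) (auto intro: same_stratum_trans[OF G] assms(2))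

lemma homotopic_along_strata_sym:
  assumes "partition_on Z G" "homotopic_along_strata X Y G p q"
  shows "homotopic_along_strata X Y G q p"
  unfolding homotopic_along_strata_def
  by (rule homotopic_along_strata_rebase[OF assms(1), where r = p])
     (use assms(2) in \<open>auto intro: same_stratum_sym dest: homotopic_along_strata_endpoint
        simp: homotopic_along_strata_def[symmetric] homotopic_with_sym[of _ X Y q]\<close>)

lemma homotopic_along_strata_trans:
  assumes "partition_on Z G" "homotopic_along_strata X Y G p q" "homotopic_along_strata X Y G q r"
  shows "homotopic_along_strata X Y G p r"
  unfolding homotopic_along_strata_def
proof (rule homotopic_with_trans)
  show "homotopic_with (\<lambda>h. \<forall>x\<in>topspace X. same_stratum G (p x) (h x)) X Y p q"
    using assms(2) by (simp add: homotopic_along_strata_def)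
  show "homotopic_with (\<lambda>h. \<forall>x\<in>topspace X. same_stratum G (p x) (h x)) X Y q r"
    by (rule homotopic_along_strata_rebase[OF assms(1), where r = q])
       (use assms(2,3) in \<open>auto intro: homotopic_along_strata_endpoint
          simp: homotopic_along_strata_def\<close>)
qed

lemma homotopic_along_strata_compose_left:
  assumes "homotopic_along_strata X Y G p q" "stratified_map Y G Z E f"
  shows "homotopic_along_strata X Z E (f \<circ> p) (f \<circ> q)"
  unfolding homotopic_along_strata_def
  by (rule homotopic_with_compose_continuous_map_left
        [OF assms(1)[unfolded homotopic_along_strata_def]])
     (use assms(2) in \<open>auto simp: stratified_map_same_stratum[OF assms(2)] stratified_map_def\<close>)

lemma homotopic_along_strata_compose_right:
  assumes "homotopic_along_strata X Y G p q" "continuous_map W X g"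
  shows "homotopic_along_strata W Y G (p \<circ> g) (q \<circ> g)"
  unfolding homotopic_along_strata_def
  by (rule homotopic_with_compose_continuous_map_right
        [OF assms(1)[unfolded homotopic_along_strata_def] assms(2)])
     (use continuous_map_image_subset_topspace[OF assms(2)] in auto)

text \<open>
  The set \<open>{x} \<times> [0, 1]\<close> lies in a single stratum of the product, so its image lies in a single
  stratum of \<open>Y\<close>.
\<close>

lemma stratified_homotopy_imp_homotopic_along_strata:
  assumes H: "stratified_map (prod_topology X unit_interval) (prod_strata F unit_interval_strata) Y G H"
    and cov: "topspace X \<subseteq> \<Union>F"
    and pq: "\<And>x. x \<in> topspace X \<Longrightarrow> H (x, 0) = p x \<and> H (x, 1) = q x"
  shows "homotopic_along_strata X Y G p q"
proof -
  have "continuous_map (prod_topology unit_interval X) Y (H \<circ> (\<lambda>z. (snd z, fst z)))"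
    using H by (intro continuous_map_compose[where X' = "prod_topology X unit_interval"])
      (auto simp: stratified_map_def intro!: continuous_intros continuous_map_fst continuous_map_snd)
  moreover have "same_stratum G (p x) (H (x, t))" if x: "x \<in> topspace X" and "t \<in> {0..1}" for x t
  proof -
    obtain S where "S \<in> F" "x \<in> S"
      using x cov by auto
    then have "same_stratum (prod_strata F unit_interval_strata) (x, 0) (x, t)"
      unfolding same_stratum_def prod_strata_def using \<open>t \<in> {0..1}\<close>
      by (intro bexI[of _ "S \<times> {0..1}"]) auto
    then show ?thesis
      using stratified_map_same_stratum[OF H] pq[OF x] by metis
  qed
  ultimately show ?thesis
    using pq unfolding homotopic_along_strata_def
    by (subst homotopic_with) (auto intro!: exI[of _ "H \<circ> (\<lambda>z. (snd z, fst z))"])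
qed

lemma homotopic_along_strata_imp_stratified_homotopy:
  assumes G: "partition_on Z G" and hom: "homotopic_along_strata X Y G p q"
    and sub: "\<Union>F \<subseteq> topspace X"
    and p: "\<And>x y. same_stratum F x y \<Longrightarrow> same_stratum G (p x) (p y)"
  obtains H where
    "stratified_map (prod_topology X unit_interval) (prod_strata F unit_interval_strata) Y G H"
    "\<And>x. H (x, 0) = p x" "\<And>x. H (x, 1) = q x"
proof -
  obtain h where h: "continuous_map (prod_topology unit_interval X) Y h"
      "\<And>x. h (0, x) = p x" "\<And>x. h (1, x) = q x"
      "\<And>t x. t \<in> {0..1} \<Longrightarrow> x \<in> topspace X \<Longrightarrow> same_stratum G (p x) (h (t, x))"
    using hom unfolding homotopic_along_strata_def homotopic_with_def by auto
  show thesis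
  proof
    have "same_stratum G (h (s, x)) (h (t, y))"
      if "S \<in> F" "x \<in> S" "y \<in> S" "s \<in> {0..1}" "t \<in> {0..1}" for S x y s t
    proof -
      have "x \<in> topspace X" "y \<in> topspace X" "same_stratum F x y"
        using that sub by (auto simp: same_stratum_def)
      \<comment> \<open>The two tracks are linked through their starting points.\<close>
      then show ?thesis
        using that h(4) p by (meson G same_stratum_sym same_stratum_trans)
    qed
    moreover have "continuous_map (prod_topology X unit_interval) Y (h \<circ> (\<lambda>z. (snd z, fst z)))"
      by (rule continuous_map_compose[OF _ h(1)])
        (auto intro!: continuous_intros continuous_map_fst continuous_map_snd)
    ultimately show "stratified_map (prod_topology X unit_interval)
        (prod_strata F unit_interval_strata) Y G (h \<circ> (\<lambda>z. (snd z, fst z)))"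
      by (auto simp: stratified_map_def prod_strata_def same_stratum_def)
  qed (simp_all add: h)
qed

section \<open>Categorical sets and transverse sets\<close>

lemma Union_induced_strata:
  assumes "partition_on (topspace X) F" "U \<subseteq> topspace X"
  shows "\<Union>(induced_strata X F U) = U"
proof -
  have "\<Union>(induced_strata X F U) =
      (\<Union>S\<in>F. \<Union>(connected_components_of (subtopology X (U \<inter> S))))"
    unfolding induced_strata_def by blast
  also have "\<dots> = (\<Union>S\<in>F. topspace X \<inter> (U \<inter> S))"
    by (simp only: Union_connected_components_of topspace_subtopology)
  also have "\<dots> = U"
    using assms partition_onD1[OF assms(1)] by auto
  finally show ?thesis .
qed

lemma same_induced_stratum_imp_same_stratum:
  assumes "same_stratum (induced_strata X F U) x y"
  shows "same_stratum F x y"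
proof -
  obtain S C where S: "S \<in> F" and C: "C \<in> connected_components_of (subtopology X (U \<inter> S))"
    and xy: "x \<in> C" "y \<in> C"
    using assms by (auto simp: same_stratum_def induced_strata_def)
  have "C \<subseteq> S"
    using connected_components_of_subset[OF C] by simp
  with S xy show ?thesis
    by (auto simp: same_stratum_def)
qed

text \<open>
  The inclusion of \<open>U\<close> sends each induced stratum, a component of some \<open>U \<inter> S\<close>, into the
  stratum \<open>S\<close>. So it is a stratified starting point, and the two conversions between
  stratified homotopies and homotopies along strata apply.
\<close>

lemma categorical_iff_homotopic_along_strata:
  assumes F: "partition_on (topspace X) F"
  shows "categorical X A F U \<longleftrightarrow> U \<subseteq> topspace X \<and> U \<noteq> {} \<and>
    (\<exists>q. homotopic_along_strata (subtopology X U) X F id q \<and> q ` U \<subseteq> A)"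
proof (cases "U \<subseteq> topspace X")
  case True
  have top: "topspace (subtopology X U) = U"
    using True by auto
  note Un = Union_induced_strata[OF F True]
  have "\<exists>q. homotopic_along_strata (subtopology X U) X F id q \<and> q ` U \<subseteq> A"
    if H: "stratified_map (prod_topology (subtopology X U) unit_interval)
            (prod_strata (induced_strata X F U) unit_interval_strata) X F H"
      and HU: "\<forall>x\<in>U. H (x, 0) = x \<and> H (x, 1) \<in> A" for H
  proof (intro exI conjI)
    show "homotopic_along_strata (subtopology X U) X F id (\<lambda>x. H (x, 1))"
      by (rule stratified_homotopy_imp_homotopic_along_strata[OF H]) (use HU Un top in auto)
    show "(\<lambda>x. H (x, 1)) ` U \<subseteq> A"
      using HU by auto
  qed
  moreover have "\<exists>H. stratified_map (prod_topology (subtopology X U) unit_interval)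
            (prod_strata (induced_strata X F U) unit_interval_strata) X F H \<and>
          (\<forall>x\<in>U. H (x, 0) = x \<and> H (x, 1) \<in> A)"
    if hom: "homotopic_along_strata (subtopology X U) X F id q" and qA: "q ` U \<subseteq> A" for q
  proof -
    obtain H where "stratified_map (prod_topology (subtopology X U) unit_interval)
        (prod_strata (induced_strata X F U) unit_interval_strata) X F H"
        "\<And>x. H (x, 0) = id x" "\<And>x. H (x, 1) = q x"
      using homotopic_along_strata_imp_stratified_homotopy
          [OF F hom, of "induced_strata X F U"]
        Un top same_induced_stratum_imp_same_stratum[of X F U] by auto
    then show ?thesis
      using qA by (intro exI[of _ H]) auto
  qed
  ultimately show ?thesis
    unfolding categorical_def by blast
qed (simp add: categorical_def)

lemma S_homotopic_imp_homotopic_along_strata: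
  assumes "partition_on (topspace X) F" "S_homotopic X F Y G p q"
  shows "homotopic_along_strata X Y G p q"
proof -
  obtain H where H: "stratified_map (prod_topology X unit_interval)
      (prod_strata F unit_interval_strata) Y G H"
      "\<forall>x\<in>topspace X. H (x, 0) = p x \<and> H (x, 1) = q x"
    using assms(2) by (auto simp: S_homotopic_def)
  show ?thesis
    by (rule stratified_homotopy_imp_homotopic_along_strata[OF H(1)])
       (use H(2) partition_onD1[OF assms(1)] in auto)
qed

text \<open>
  Since \<open>f\<close> separates strata, only one stratum of \<open>X\<close> contributes to the intersection of
  \<open>f ` A\<close> with a stratum of \<open>X'\<close>.
\<close>

lemma transverse_image:
  assumes F: "partition_on (topspace X) F" and f: "continuous_map X Y f"
    and sep: "\<And>x y. \<lbrakk>x \<in> topspace X; y \<in> topspace X; same_stratum G (f x) (f y)\<rbrakk>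
                \<Longrightarrow> same_stratum F x y"
    and A: "transverse X A F"
  shows "transverse Y (f ` A) G"
  unfolding transverse_def
proof (intro conjI ballI)
  have AX: "A \<subseteq> topspace X"
    using A by (simp add: transverse_def)
  then show "f ` A \<subseteq> topspace Y"
    using continuous_map_image_subset_topspace[OF f] by auto
  fix T assume T: "T \<in> G"
  show "countable (f ` A \<inter> T)"
  proof (cases "f ` A \<inter> T = {}")
    case False
    then obtain a where a: "a \<in> A" "f a \<in> T" by auto
    then obtain S where S: "S \<in> F" "a \<in> S"
      using AX partition_onD1[OF F] by auto
    have "f ` A \<inter> T \<subseteq> f ` (A \<inter> S)"
    proof clarify
      fix b assume b: "b \<in> A" "f b \<in> T"
      have "same_stratum F a b"
        using a b T AX by (intro sep) (auto simp: same_stratum_def)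
      then have "b \<in> S"
        using S partition_onD2[OF F] by (auto simp: same_stratum_def disjoint_def)
      with b show "f b \<in> f ` (A \<inter> S)" by auto
    qed
    moreover have "countable (f ` (A \<inter> S))"
      using A S by (auto simp: transverse_def)
    ultimately show ?thesis
      by (rule countable_subset)
  qed simp
qed

text \<open>
  The deformation of the preimage runs from the inclusion to \<open>f \<circ> g\<close> and from there, following the
  deformation of \<open>U\<close>, into \<open>f ` A\<close>.
\<close>

lemma categorical_preimage:
  assumes F: "partition_on (topspace X) F" and G: "partition_on (topspace Y) G"
    and f: "stratified_map X F Y G f" and g: "continuous_map Y X g"
    and fg: "homotopic_along_strata Y Y G (f \<circ> g) id"
    and U: "categorical X A F U"
    and V: "V = {y \<in> topspace Y. g y \<in> U}" "V \<noteq> {}"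
  shows "categorical Y (f ` A) G V"
proof -
  obtain q where q: "homotopic_along_strata (subtopology X U) X F id q" "q ` U \<subseteq> A"
    using U by (auto simp: categorical_iff_homotopic_along_strata[OF F])
  have "homotopic_along_strata (subtopology Y V) Y G ((f \<circ> g) \<circ> id) (id \<circ> id)"
    by (rule homotopic_along_strata_compose_right[OF fg]) (simp add: continuous_map_from_subtopology)
  then have 1: "homotopic_along_strata (subtopology Y V) Y G id (f \<circ> g)"
    using homotopic_along_strata_sym[OF G] by force
  have gV: "continuous_map (subtopology Y V) (subtopology X U) g"
    using g V by (auto simp: continuous_map_in_subtopology continuous_map_from_subtopology)
  have "homotopic_along_strata (subtopology Y V) Y G (f \<circ> (id \<circ> g)) (f \<circ> (q \<circ> g))"
    by (intro homotopic_along_strata_compose_left[OF _ f]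
          homotopic_along_strata_compose_right[OF q(1) gV])
  with 1 have "homotopic_along_strata (subtopology Y V) Y G id (f \<circ> (q \<circ> g))"
    using homotopic_along_strata_trans[OF G] by force
  moreover have "(f \<circ> (q \<circ> g)) ` V \<subseteq> f ` A"
    using q(2) V by auto
  ultimately show ?thesis
    using V unfolding categorical_iff_homotopic_along_strata[OF G] by blast
qed

section \<open>Homotopy invariance\<close>

lemma Ocat_rel_image_le:
  assumes F: "partition_on (topspace X) F" and G: "partition_on (topspace Y) G"
    and f: "stratified_map X F Y G f" and g: "continuous_map Y X g"
    and fg: "homotopic_along_strata Y Y G (f \<circ> g) id"
  shows "Ocat_rel Y (f ` A) G \<le> Ocat_rel X A F"
  unfolding Ocat_rel_def
proof (rule Inf_superset_mono, clarify)
  fix n and U :: "nat \<Rightarrow> 'a set"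
  assume U: "\<forall>i\<le>n. openin X (U i) \<and> categorical X A F (U i)"
    and cov: "topspace X = (\<Union>i\<le>n. U i)"
  define V where "V i = {y \<in> topspace Y. g y \<in> U i}" for i
  have covV: "topspace Y = (\<Union>i\<le>n. V i)"
    using cov continuous_map_image_subset_topspace[OF g] by (auto simp: V_def)
  have openV: "openin Y (V i)" if "i \<le> n" for i
    unfolding V_def using U that by (intro openin_continuous_map_preimage[OF g]) auto
  have catV: "categorical Y (f ` A) G (V i)" if "i \<le> n" "V i \<noteq> {}" for i
    using categorical_preimage[OF F G f g fg _ V_def that(2)] U that(1) by auto
  have "U 0 \<subseteq> topspace X" "U 0 \<noteq> {}"
    using U by (auto simp: categorical_def)
  then have "topspace Y \<noteq> {}"
    using f by (auto simp: stratified_map_def continuous_map_def Pi_iff)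
  then obtain j where j: "j \<le> n" "V j \<noteq> {}"
    using covV by auto
  \<comment> \<open>Categorical sets are non-empty, so an empty preimage is replaced by a fixed non-empty one.\<close>
  define W where "W i = (if V i = {} then V j else V i)" for i
  have "\<forall>i\<le>n. openin Y (W i) \<and> categorical Y (f ` A) G (W i)"
    using openV catV j by (auto simp: W_def)
  moreover have "topspace Y = (\<Union>i\<le>n. W i)"
    using j by (force simp: W_def covV split: if_splits)
  ultimately show "\<exists>m. enat n = enat m \<and> (\<exists>W :: nat \<Rightarrow> 'b set.
      (\<forall>i\<le>m. openin Y (W i) \<and> categorical Y (f ` A) G (W i)) \<and> topspace Y = (\<Union>i\<le>m. W i))"
    by blast
qed

lemma Ocat_le_if_homotopy_equivalence:
  assumes X: "stratified_space X F" and Y: "stratified_space Y G"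
    and f: "stratified_map X F Y G f" and g: "stratified_map Y G X F g"
    and fg: "S_homotopic Y G Y G (f \<circ> g) id" and gf: "S_homotopic X F X F (g \<circ> f) id"
  shows "Ocat Y G \<le> Ocat X F"
proof -
  have F: "partition_on (topspace X) F" and G: "partition_on (topspace Y) G"
    using X Y by (simp_all add: stratified_space_def)
  note FG = S_homotopic_imp_homotopic_along_strata[OF G fg]
  note GF = S_homotopic_imp_homotopic_along_strata[OF F gf]
  have cont: "continuous_map X Y f" "continuous_map Y X g"
    using f g by (auto simp: stratified_map_def)
  have sep: "same_stratum F x y"
    if "x \<in> topspace X" "y \<in> topspace X" "same_stratum G (f x) (f y)" for x y
  proof -
    have "same_stratum F (g (f x)) (g (f y))"
      using stratified_map_same_stratum[OF g that(3)] .
    moreover have "same_stratum F (g (f x)) x" "same_stratum F (g (f y)) y"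
      using homotopic_along_strata_endpoint[OF GF] that by auto
    ultimately show ?thesis
      by (meson F same_stratum_sym same_stratum_trans)
  qed
  show ?thesis
    unfolding Ocat_def
  proof (rule Inf_mono, clarify)
    fix A assume "transverse X A F"
    then have "transverse Y (f ` A) G"
      using transverse_image[OF F cont(1) sep] by blast
    moreover have "Ocat_rel Y (f ` A) G \<le> Ocat_rel X A F"
      by (rule Ocat_rel_image_le[OF F G f cont(2) FG])
    ultimately show "\<exists>k\<in>{Ocat_rel Y B G |B. transverse Y B G}. k \<le> Ocat_rel X A F"
      by blast
  qed
qed

theorem theorem4:
  fixes X :: "'a topology" and FX :: "'a set set"
    and X' :: "'b topology" and FX' :: "'b set set"
    and f :: "'a \<Rightarrow> 'b" and g :: "'b \<Rightarrow> 'a"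
  assumes "stratified_space X FX"
    and "stratified_space X' FX'"
    and "stratified_map X FX X' FX' f"
    and "stratified_map X' FX' X FX g"
    and "S_homotopic X' FX' X' FX' (f \<circ> g) id"
    and "S_homotopic X FX X FX (g \<circ> f) id"
  shows "Ocat X FX = Ocat X' FX'"
  using Ocat_le_if_homotopy_equivalence[OF assms(1-6)]
    Ocat_le_if_homotopy_equivalence[OF assms(2,1,4,3,6,5)]
  by (rule antisym[rotated])

end
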